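(* Let $n\ge 2$ and let $\mathbb{F}$ be a field with at least $n$ pairwise different elements. The abstract invariants of width one $$\mathrm{rank}_t(F),\quad\text{where } 0\le t\le n \text{ and } F\in \mathrm{alg}_{\mathbb{F}}\{X\}_2 \text{ with } \deg(F)\le (n+1)(2n-1),$$ separate $\mathrm{GL}_n$-orbits on $D_n$; that is, if $\underline{A},\underline{B}\in D_n$ and $\mathrm{rank}_t(F(\underline{A}))=\mathrm{rank}_t(F(\underline{B}))$ for all such $t$ and $F$, then $\mathrm{GL}_n\cdot\underline{A}=\mathrm{GL}_n\cdot\underline{B}$.
   Context: $\mathbb{F}$ is a field (possibly finite, of arbitrary characteristic). $M_n$ is the space of $n\times n$ matrices over $\mathbb{F}$, and $\mathrm{GL}_n=\mathrm{GL}_n(\mathbb{F})$ acts on $M_n^m$ by simultaneous conjugation: $g\cdot(A_1,\ldots,A_m)=(gA_1g^{-1},\ldots,gA_mg^{-1})$. $D_n\subset M_n^2$ is the set of all pairs $\underline{A}=(A_1,A_2)$ such that $A_1$ has $n$ distinct eigenvalues in $\mathbb{F}$; it is $\mathrm{GL}_n$-invariant. For $1\le k\le m$, $X_k=(x_{ij}(k))_{1\le i,j\le n}$ is the generic $n\times n$ matrix whose entries are independent commuting variables, and $\mathrm{alg}_{\mathbb{F}}\{X\}_m$ is the associative $\mathbb{F}$-algebra generated by $X_1,\ldots,X_m$ and the identity matrix $I_n$. For $F\in \mathrm{alg}_{\mathbb{F}}\{X\}_m$ and $\underline{A}\in M_n^m$, $F(\underline{A})\in M_n$ is the result of substituting $X_k\mapsto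 A_k$. The degree $\deg(F)$ is the minimal degree of a non-commutative polynomial $f$ in letters $x_1,\ldots,x_m$ over $\mathbb{F}$ such that $F=f(X_1,\ldots,X_m)$. An abstract (matrix) invariant on $M_n^m$ is an arbitrary function $f:M_n^m\to\mathbb{F}$ with $f(g\cdot\underline{A})=f(\underline{A})$ for all $g\in\mathrm{GL}_n$, $\underline{A}\in M_n^m$; these form the algebra $\mathcal{F}_{n,m}^{\mathrm{GL}_n}$. The width of $f\in \mathcal{F}_{n,m}^{\mathrm{GL}_n}$ is the smallest $d>0$ such that there are $h\in\mathcal{F}_{n,d}^{\mathrm{GL}_n}$ and $F_1,\ldots,F_d\in \mathrm{alg}_{\mathbb{F}}\{X\}_m$ with $f(\underline{A})=h(F_1(\underline{A}),\ldots,F_d(\underline{A}))$ for all $\underline{A}\in M_n^m$. For $0\le t\le n$ the function $\mathrm{rank}_t:M_n\to\mathbb{F}$ is given by $\mathrm{rank}_t(A)=1$ if $\mathrm{rank}(A)=t$ and $\mathrm{rank}_t(A)=0$ otherwise; $\mathrm{rank}_t(F)$ denotes the function $\underline{A}\mapsto \mathrm{rank}_t(F(\underline{A}))$. *)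

theory Defs
  imports
    "HOL-Library.Poly_Mapping"
    "Jordan_Normal_Form.Matrix"
    "Jordan_Normal_Form.Char_Poly"
    "Jordan_Normal_Form.DL_Rank"
begin

text \<open>
  Tuples in \<open>M\<^sub>n\<^sup>m\<close> are lists of length \<open>m\<close>. Matrix indices and letters are counted from \<open>0\<close>,
  so the generic matrices are \<open>X\<^sub>0, \<dots>, X\<^bsub>m-1\<^esub>\<close>.
\<close>

definition mat_tuples :: "nat \<Rightarrow> nat \<Rightarrow> 'a mat list set" where
  "mat_tuples n m = {As. length As = m \<and> set As \<subseteq> carrier_mat n n}"

definition GL :: "nat \<Rightarrow> 'a :: field mat set" where
  "GL n = Units (ring_mat TYPE('a) n ())"

definition conj_act :: "nat \<Rightarrow> 'a :: field mat \<Rightarrow> 'a mat list \<Rightarrow> 'a mat list" where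
  "conj_act n g As = map (\<lambda>A. g * A * inv\<^bsub>ring_mat TYPE('a) n ()\<^esub> g) As"

definition GL_orbit :: "nat \<Rightarrow> 'a :: field mat list \<Rightarrow> 'a mat list set" where
  "GL_orbit n As = {conj_act n g As | g. g \<in> GL n}"

definition D_set :: "nat \<Rightarrow> 'a :: field mat list set" where
  "D_set n = {As \<in> mat_tuples n 2. card {c. eigenvalue (As ! 0) c} = n}"

text \<open>
  Commutative polynomials in the entries \<open>x\<^sub>i\<^sub>j(k)\<close>, the variable being indexed by \<open>(i, j, k)\<close>.
  They have to be formal polynomials, not polynomial functions: over a finite field, the latter
  would identify distinct elements of the algebra of generic matrices.
\<close>

type_synonym 'a gpoly = "(nat \<times> nat \<times> nat \<Rightarrow>\<^sub>0 nat) \<Rightarrow>\<^sub>0 'a"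

definition gconst :: "'a :: field \<Rightarrow> 'a gpoly" where
  "gconst c = Poly_Mapping.single 0 c"

definition gvar :: "nat \<times> nat \<times> nat \<Rightarrow> 'a :: field gpoly" where
  "gvar v = Poly_Mapping.single (Poly_Mapping.single v 1) 1"

definition geval :: "(nat \<times> nat \<times> nat \<Rightarrow> 'a :: field) \<Rightarrow> 'a gpoly \<Rightarrow> 'a" where
  "geval a p = (\<Sum>u\<in>Poly_Mapping.keys p.
     Poly_Mapping.lookup p u * (\<Prod>v\<in>Poly_Mapping.keys u. a v ^ Poly_Mapping.lookup u v))"

definition generic_mat :: "nat \<Rightarrow> nat \<Rightarrow> 'a :: field gpoly mat" where
  "generic_mat n k = mat n n (\<lambda>(i, j). gvar (i, j, k))"

inductive_set generic_alg :: "nat \<Rightarrow> nat \<Rightarrow> 'a :: field gpoly mat set" for n m :: nat where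
  one: "1\<^sub>m n \<in> generic_alg n m"
| gen: "k < m \<Longrightarrow> generic_mat n k \<in> generic_alg n m"
| add: "F \<in> generic_alg n m \<Longrightarrow> G \<in> generic_alg n m \<Longrightarrow> F + G \<in> generic_alg n m"
| mult: "F \<in> generic_alg n m \<Longrightarrow> G \<in> generic_alg n m \<Longrightarrow> F * G \<in> generic_alg n m"
| smult: "F \<in> generic_alg n m \<Longrightarrow> gconst c \<cdot>\<^sub>m F \<in> generic_alg n m"

definition gsubst :: "'a :: field mat list \<Rightarrow> 'a gpoly mat \<Rightarrow> 'a mat" where
  "gsubst As F = map_mat (geval (\<lambda>(i, j, k). (As ! k) $$ (i, j))) F"

text \<open>
  A non-commutative polynomial is a finitely supported function from words to coefficients.
  Here the zero polynomial has degree \<open>0\<close>.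
\<close>

type_synonym 'a ncpoly = "nat list \<Rightarrow>\<^sub>0 'a"

definition nc_letters :: "nat \<Rightarrow> 'a :: field ncpoly set" where
  "nc_letters m = {f. \<forall>w\<in>Poly_Mapping.keys f. set w \<subseteq> {..<m}}"

definition nc_degree :: "'a :: field ncpoly \<Rightarrow> nat" where
  "nc_degree f = Max (insert 0 (length ` Poly_Mapping.keys f))"

definition generic_word :: "nat \<Rightarrow> nat list \<Rightarrow> 'a :: field gpoly mat" where
  "generic_word n w = foldr (\<lambda>k M. generic_mat n k * M) w (1\<^sub>m n)"

definition nc_eval_generic :: "nat \<Rightarrow> 'a :: field ncpoly \<Rightarrow> 'a gpoly mat" where
  "nc_eval_generic n f = mat n n (\<lambda>ij.
     \<Sum>w\<in>Poly_Mapping.keys f. gconst (Poly_Mapping.lookup f w) * generic_word n w $$ ij)"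

definition generic_deg :: "nat \<Rightarrow> nat \<Rightarrow> 'a :: field gpoly mat \<Rightarrow> nat" where
  "generic_deg n m F = (LEAST d. \<exists>f\<in>nc_letters m. nc_degree f = d \<and> F = nc_eval_generic n f)"

text \<open>
  Functions on \<open>M\<^sub>n\<^sup>m\<close> are total functions on lists whose values outside
  \<open>mat_tuples n m\<close> are irrelevant.
\<close>

definition abstract_invariants :: "nat \<Rightarrow> nat \<Rightarrow> ('a :: field mat list \<Rightarrow> 'a) set" where
  "abstract_invariants n m = {f. \<forall>As\<in>mat_tuples n m. \<forall>g\<in>GL n. f (conj_act n g As) = f As}"

definition width :: "nat \<Rightarrow> nat \<Rightarrow> ('a :: field mat list \<Rightarrow> 'a) \<Rightarrow> nat" where
  "width n m f = (LEAST d. d > 0 \<and>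
     (\<exists>h\<in>abstract_invariants n d. \<exists>Fs. length Fs = d \<and> set Fs \<subseteq> generic_alg n m \<and>
        (\<forall>As\<in>mat_tuples n m. f As = h (map (gsubst As) Fs))))"

definition rank_ind :: "nat \<Rightarrow> nat \<Rightarrow> 'a :: field mat \<Rightarrow> 'a" where
  "rank_ind n t A = (if vec_space.rank n A = t then 1 else 0)"

definition rank_inv :: "nat \<Rightarrow> nat \<Rightarrow> 'a :: field gpoly mat \<Rightarrow> 'a mat list \<Rightarrow> 'a" where
  "rank_inv n t F As = rank_ind n t (gsubst As F)"

end

theory Submission
  imports Defs "Jordan_Normal_Form.Matrix_Kernel"
begin

text \<open>
  Conjugating \<open>A\<^sub>0\<close> to a diagonal matrix with distinct entries \<open>e\<^sub>i\<close>, which are determined by the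
  ranks of \<open>A\<^sub>0 - c I\<close>, the pair becomes \<open>(diag e, P)\<close>, and by interpolation the combinations of the
  words \<open>X\<^sub>0\<^sup>a\<close> and \<open>X\<^sub>0\<^sup>a X\<^sub>1 X\<^sub>0\<^sup>b\<close> with \<open>a, b < n\<close> take all the values
  \<open>diag \<gamma> + C \<circ> P\<close> (entrywise product), with coefficients that do not depend on \<open>P\<close>.
  So degree \<open>2n - 1\<close> suffices. The ranks of these matrices give the diagonal of \<open>P\<close>. Replacing it by
  ones, they give the ranks of all \<open>C \<circ> P\<close>, which determine \<open>P\<close> up to multiplication by
  diagonal matrices from both sides: if \<open>P\<close> and \<open>Q\<close> agree on a set of positions, and another position
  closes a cycle with them in the bipartite graph of rows and columns, then a suitable \<open>C\<close> makes
  \<open>C \<circ> Q\<close> have vanishing row and column sums and differ from \<open>C \<circ> P\<close> at most at that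
  position, and then equality of the ranks forces equality there. As the diagonal entries are ones, the
  two diagonal matrices are inverse to each other, so that the equivalence is a conjugation.
\<close>

section \<open>Ranks of perturbed matrices\<close>

text \<open>A basis of \<open>X\<close> stays independent in the whole space; with
  \<open>dim\<close> many elements it would be a basis there, and its span \<open>X\<close> would be
  everything.\<close>

lemma (in vectorspace) dim_proper_subspace:
  assumes X: "subspace K X V" and neq: "X \<noteq> carrier V" and fin: "fin_dim"
    and finX: "vectorspace.fin_dim K (vs X)"
  shows "vectorspace.dim K (vs X) < dim"
proof -
  interpret X: vectorspace K "vs X" using X by (rule subspace_is_vs)
  have sub: "submodule K X V" using X by (simp add: subspace_def)
  obtain b where b: "finite b" "X.basis b" using X.finite_basis_exists[OF finX] by blast
  then have bX: "b \<subseteq> X" and liX: "X.lin_indpt b" and genX: "X.gen_set b"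
    by (auto simp: X.basis_def)
  have XV: "X \<subseteq> carrier V" using sub by (simp add: submodule_def)
  have li: "lin_indpt b" using span_li_not_depend(2)[OF bX sub] liX by simp
  have span_b: "span b = X" using span_li_not_depend(1)[OF bX sub] genX by simp
  have le: "card b \<le> dim" using li_le_dim(2)[OF fin _ li] bX XV by auto
  have "card b \<noteq> dim"
  proof
    assume "card b = dim"
    then have "basis b" using dim_li_is_basis[OF fin b(1) _ li] bX XV by auto
    then show False using span_b neq by (simp add: basis_def)
  qed
  then show ?thesis using le X.dim_basis[OF b] by simp
qed

text \<open>Rank-nullity for \<open>\<lambda>v. A *\<^sub>v v\<close>, whose image is the column
  space and whose kernel is \<open>mat_kernel A\<close>.\<close>

lemma
  fixes A :: "'a :: field mat"
  assumes A: "A \<in> carrier_mat n n"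
  shows rank_plus_kernel_dim: "vec_space.rank n A + kernel.dim n A = n"
    and mat_kernel_subspace: "subspace class_ring (mat_kernel A) (module_vec TYPE('a) n)"
proof -
  interpret V: vec_space "TYPE('a)" n .
  interpret L: linear_map class_ring V.V V.V "\<lambda>v. A *\<^sub>v v"
    using A by unfold_locales
      (auto simp: module_hom_def module_vec_simps mult_add_distrib_mat_vec[OF A] mult_mat_vec[OF A] class_ring_simps)
  have "L.imT = V.span (set (cols A))"
    using V.col_space_eq[OF A] A unfolding V.col_space_def by (auto simp: L.im_def)
  moreover have ker: "L.kerT = mat_kernel A"
    using A by (auto simp: L.ker_def mat_kernel_def)
  ultimately show "vec_space.rank n A + kernel.dim n A = n"
    using L.rank_nullity[OF V.fin_dim] V.dim_is_n unfolding V.rank_def by simp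
  show "subspace class_ring (mat_kernel A) (module_vec TYPE('a) n)"
    using L.kerT_is_subspace unfolding ker .
qed

text \<open>The left factor leaves the kernel unchanged, the right factor preserves its dimension;
  rank-nullity translates this into ranks.\<close>

lemma rank_mult_invertible:
  fixes A :: "'a :: field mat"
  assumes A: "A \<in> carrier_mat n n"
    and U: "U \<in> carrier_mat n n" "U' \<in> carrier_mat n n" "U' * U = 1\<^sub>m n"
    and V: "V \<in> carrier_mat n n" "V' \<in> carrier_mat n n" "V * V' = 1\<^sub>m n"
  shows "vec_space.rank n (U * A * V) = vec_space.rank n A"
proof -
  have UA: "U * A \<in> carrier_mat n n" using A U by auto
  have "kernel.dim n (U * A * V) = kernel.dim n (U * A)"
    by (rule mat_kernel_dim_mult_eq_right[OF UA V])
  also have "\<dots> = kernel.dim n A" 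
    by (simp add: mat_kernel_mult_eq[OF A U])
  finally show ?thesis
    using rank_plus_kernel_dim[OF A] rank_plus_kernel_dim[of "U * A * V" n] A U V by simp
qed

text \<open>The smaller kernel is a proper subspace of the larger one, hence has smaller dimension;
  rank-nullity reverses the inequality.\<close>

lemma rank_less_if_mat_kernel_psubset:
  fixes M N :: "'a :: field mat"
  assumes M: "M \<in> carrier_mat n n" and N: "N \<in> carrier_mat n n"
    and ker: "mat_kernel N \<subset> mat_kernel M"
  shows "vec_space.rank n M < vec_space.rank n N"
proof -
  interpret V: vec_space "TYPE('a)" n .
  interpret M: kernel n n M by unfold_locales (rule M)
  interpret N: kernel n n N by unfold_locales (rule N)
  have "subspace class_ring (mat_kernel N) M.VK"
    using V.nested_subspaces[OF mat_kernel_subspace[OF M] mat_kernel_subspace[OF N]] ker by auto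
  moreover have "M.Ker.fin_dim" "N.Ker.fin_dim"
    using kernel_basis_exists[OF M] kernel_basis_exists[OF N]
    by (auto simp: M.Ker.fin_dim_def M.Ker.basis_def N.Ker.fin_dim_def N.Ker.basis_def)
  ultimately have "N.dim < M.dim"
    using M.Ker.dim_proper_subspace[of "mat_kernel N"] ker by auto
  then show ?thesis
    using rank_plus_kernel_dim[OF M] rank_plus_kernel_dim[OF N] by simp
qed

text \<open>Zero row sums put the all-ones vector into the kernel of \<open>M\<close>; zero column
  sums make the entries of every \<open>M *\<^sub>v v\<close> add up to zero. So if the perturbed
  matrix kills \<open>v\<close>, adding the entries leaves \<open>x * v $ j = 0\<close>, and then
  \<open>M\<close> kills \<open>v\<close> too. The kernel thus shrinks, strictly because it loses
  the all-ones vector, and the rank grows.\<close>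

lemma rank_add_unit_neq:
  fixes M :: "'a :: field mat"
  assumes M: "M \<in> carrier_mat n n" and ij: "i < n" "j < n" and x: "x \<noteq> 0"
    and rows: "\<And>r. r < n \<Longrightarrow> (\<Sum>c<n. M $$ (r, c)) = 0"
    and cols: "\<And>c. c < n \<Longrightarrow> (\<Sum>r<n. M $$ (r, c)) = 0"
  shows "vec_space.rank n (M + mat n n (\<lambda>rc. if rc = (i, j) then x else 0)) \<noteq> vec_space.rank n M"
    (is "vec_space.rank n ?N \<noteq> _")
proof -
  have N: "?N \<in> carrier_mat n n" using M by auto
  let ?w = "vec n (\<lambda>_. 1) :: 'a vec"
  have wM: "?w \<in> mat_kernel M"
    using M rows by (intro mat_kernelI[OF M]) (auto simp: scalar_prod_def lessThan_atLeast0)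
  have entry: "(?N *\<^sub>v v) $ r = (M *\<^sub>v v) $ r + (if r = i then x * v $ j else 0)"
    if "v \<in> carrier_vec n" "r < n" for v r
    using that M ij
    by (auto simp: scalar_prod_def algebra_simps sum.distrib if_distrib[of "\<lambda>y. v $ _ * y"] cong: if_cong)
  have sum0: "(\<Sum>r<n. (M *\<^sub>v v) $ r) = 0" if v: "v \<in> carrier_vec n" for v
  proof -
    have "(\<Sum>r<n. (M *\<^sub>v v) $ r) = (\<Sum>r<n. \<Sum>c<n. M $$ (r, c) * v $ c)"
      using v M by (auto simp: scalar_prod_def lessThan_atLeast0)
    also have "\<dots> = (\<Sum>c<n. (\<Sum>r<n. M $$ (r, c)) * v $ c)"
      by (subst sum.swap) (simp add: sum_distrib_right)
    finally show ?thesis by (simp add: cols)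
  qed
  have "v \<in> mat_kernel M \<and> v $ j = 0" if "v \<in> mat_kernel ?N" for v
  proof -
    have v: "v \<in> carrier_vec n" and Nv: "?N *\<^sub>v v = 0\<^sub>v n" using mat_kernelD[OF N that] by auto
    have Mv: "(M *\<^sub>v v) $ r + (if r = i then x * v $ j else 0) = 0" if "r < n" for r
      using entry[OF v that] that unfolding Nv by simp
    have "0 = (\<Sum>r<n. (M *\<^sub>v v) $ r + (if r = i then x * v $ j else 0))"
      using Mv by simp
    also have "\<dots> = x * v $ j" using sum0[OF v] ij by (simp add: sum.distrib)
    finally have vj: "v $ j = 0" using x by simp
    have "(M *\<^sub>v v) $ r = 0" if "r < n" for r
      using Mv[OF that] unfolding vj by (auto split: if_splits)
    then have "M *\<^sub>v v = 0\<^sub>v n" using M by (intro eq_vecI) auto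
    then show ?thesis using v M vj by (auto intro: mat_kernelI)
  qed
  then have "mat_kernel ?N \<subset> mat_kernel M" using wM ij by force
  then show ?thesis using rank_less_if_mat_kernel_psubset[OF M N] by simp
qed

section \<open>Diagonal equivalence from ranks of entrywise products\<close>

lemma mat_diag_inverse:
  fixes x :: "nat \<Rightarrow> 'a :: field"
  assumes "\<And>i. x i \<noteq> 0"
  shows "mat_diag n x * mat_diag n (\<lambda>i. 1 / x i) = 1\<^sub>m n" "mat_diag n (\<lambda>i. 1 / x i) * mat_diag n x = 1\<^sub>m n"
  using assms by simp_all

lemma mat_diag_mult_mat_diag:
  fixes A :: "'a :: comm_ring_1 mat"
  assumes A: "A \<in> carrier_mat n n"
  shows "mat_diag n f * A * mat_diag n g = mat n n (\<lambda>(i, j). f i * A $$ (i, j) * g j)"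
proof -
  have "mat_diag n f * A \<in> carrier_mat n n" using A by (rule mult_carrier_mat[OF mat_diag_dim])
  from mat_diag_mult_right[OF this] show ?thesis
    unfolding mat_diag_mult_left[OF A] by (auto intro: eq_matI)
qed

text \<open>
  The matrices \<open>M\<close> are signed sums along paths from row \<open>i\<close> to column \<open>j\<close>. Only their row and
  column sums matter, so that no path has to be made simple.
\<close>

lemma reachable_balance:
  fixes E :: "(nat \<times> nat) set"
  assumes ES: "E \<subseteq> {..<n} \<times> {..<n}"
  shows "\<exists>R K. i \<in> R \<and> (\<forall>r c. (r, c) \<in> E \<longrightarrow> (r \<in> R \<longleftrightarrow> c \<in> K)) \<and>
    (\<forall>j\<in>K. \<exists>M :: nat \<Rightarrow> nat \<Rightarrow> 'a :: comm_ring_1.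
       (\<forall>r c. M r c \<noteq> 0 \<longrightarrow> (r, c) \<in> E) \<and>
       (\<forall>r. (\<Sum>c<n. M r c) = (if r = i then 1 else 0)) \<and>
       (\<forall>c. (\<Sum>r<n. M r c) = (if c = j then 1 else 0)))"
proof -
  define unit :: "nat \<Rightarrow> nat \<Rightarrow> 'a" where "unit a b = (if b = a then 1 else 0)" for a b
  define supp where "supp M \<longleftrightarrow> (\<forall>r c. M r c \<noteq> 0 \<longrightarrow> (r, c) \<in> E)" for M :: "nat \<Rightarrow> nat \<Rightarrow> 'a"
  \<comment> \<open>\<open>R\<close> and \<open>K\<close> play the role of the rows and columns
    reachable from row \<open>i\<close> along \<open>E\<close>. A walk is recorded by the
    alternating sum of its edges: if it ends in row \<open>r\<close>, the row sums are
    \<open>unit i - unit r\<close> and the column sums vanish; if it ends in column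
    \<open>c\<close>, the sums are the units at \<open>i\<close> and \<open>c\<close>.\<close>
  define R where "R = {r. \<exists>M. supp M \<and> (\<forall>a. (\<Sum>c<n. M a c) = unit i a - unit r a) \<and> (\<forall>c. (\<Sum>a<n. M a c) = 0)}"
  define K where "K = {c. \<exists>M. supp M \<and> (\<forall>a. (\<Sum>b<n. M a b) = unit i a) \<and> (\<forall>b. (\<Sum>a<n. M a b) = unit c b)}"
  have sum_unit: "(\<Sum>b<n. unit c b) = 1" if "c < n" for c
    using that by (simp add: unit_def)
  have "i \<in> R" unfolding R_def by (auto simp: supp_def intro!: exI[of _ "\<lambda>_ _. 0"])
  moreover have "c \<in> K" if rc: "(r, c) \<in> E" and r: "r \<in> R" for r c
  proof -
    obtain M where M: "supp M" "\<And>a. (\<Sum>b<n. M a b) = unit i a - unit r a" "\<And>b. (\<Sum>a<n. M a b) = 0"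
      using r unfolding R_def by blast
    have "r < n" "c < n" using rc ES by auto
    \<comment> \<open>Going from a row to a column appends the edge with sign \<open>+\<close>;
      going back from a column to a row appends it with sign \<open>-\<close>.\<close>
    moreover have "supp (\<lambda>a b. M a b + unit r a * unit c b)"
      using M(1) rc by (auto simp: supp_def unit_def)
    ultimately show ?thesis unfolding K_def
      by (intro CollectI exI[of _ "\<lambda>a b. M a b + unit r a * unit c b"])
        (simp add: M sum.distrib sum_unit flip: sum_distrib_left sum_distrib_right)
  qed
  moreover have "r \<in> R" if rc: "(r, c) \<in> E" and c: "c \<in> K" for r c
  proof -
    obtain M where M: "supp M" "\<And>a. (\<Sum>b<n. M a b) = unit i a" "\<And>b. (\<Sum>a<n. M a b) = unit c b"
      using c unfolding K_def by blast
    have "r < n" "c < n" using rc ES by auto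
    moreover have "supp (\<lambda>a b. M a b - unit r a * unit c b)"
      using M(1) rc by (auto simp: supp_def unit_def)
    ultimately show ?thesis unfolding R_def
      by (intro CollectI exI[of _ "\<lambda>a b. M a b - unit r a * unit c b"])
        (simp add: M sum_subtractf sum_unit flip: sum_distrib_left sum_distrib_right)
  qed
  ultimately have "i \<in> R \<and> (\<forall>r c. (r, c) \<in> E \<longrightarrow> (r \<in> R \<longleftrightarrow> c \<in> K))" by blast
  then show ?thesis
    by (intro exI[of _ R] exI[of _ K]) (simp add: K_def supp_def unit_def)
qed

text \<open>Positions are added to \<open>E\<close> one at a time. If the new position joins two
  components of the bipartite graph, rescaling one of them accommodates it; if it closes a cycle,
  the rank hypothesis shows that the old scaling already fits.\<close>

lemma diagonally_equivalent_on:
  fixes p q :: "nat \<Rightarrow> nat \<Rightarrow> 'a :: field"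
  assumes rank: "\<And>C. vec_space.rank n (mat n n (\<lambda>(r, c). C r c * p r c)) =
      vec_space.rank n (mat n n (\<lambda>(r, c). C r c * q r c))"
    and supp: "\<And>r c. r < n \<Longrightarrow> c < n \<Longrightarrow> p r c = 0 \<longleftrightarrow> q r c = 0"
    and E: "E \<subseteq> {(r, c). r < n \<and> c < n \<and> q r c \<noteq> 0}"
  obtains x y where "\<And>r. x r \<noteq> 0" "\<And>c. y c \<noteq> 0" "\<And>r c. (r, c) \<in> E \<Longrightarrow> q r c = x r * p r c * y c"
proof -
  have fin: "finite E" using E by (rule finite_subset) (auto intro: finite_subset[of _ "{..<n} \<times> {..<n}"])
  have "\<exists>x y. (\<forall>r. x r \<noteq> 0) \<and> (\<forall>c. y c \<noteq> 0) \<and> (\<forall>r c. (r, c) \<in> E \<longrightarrow> q r c = x r * p r c * y c)"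
    using fin E
  proof (induction E rule: finite_induct)
    case empty
    show ?case by (intro exI[of _ "\<lambda>_. 1"]) auto
  next
    case (insert e E)
    obtain i j where e: "e = (i, j)" by fastforce
    have ij: "i < n" "j < n" "q i j \<noteq> 0" "p i j \<noteq> 0" and notE: "(i, j) \<notin> E"
      using insert e supp by auto
    obtain x y where xy: "\<And>r. x r \<noteq> 0" "\<And>c. y c \<noteq> 0"
      and eq: "\<And>r c. (r, c) \<in> E \<Longrightarrow> q r c = x r * p r c * y c"
      using insert.IH insert.prems by auto
    have En: "E \<subseteq> {..<n} \<times> {..<n}" using insert by auto
    obtain R K where R: "i \<in> R" and RK: "\<And>r c. (r, c) \<in> E \<Longrightarrow> r \<in> R \<longleftrightarrow> c \<in> K"
      and reach: "\<forall>j\<in>K. \<exists>M :: nat \<Rightarrow> nat \<Rightarrow> 'a.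
       (\<forall>r c. M r c \<noteq> 0 \<longrightarrow> (r, c) \<in> E) \<and>
       (\<forall>r. (\<Sum>c<n. M r c) = (if r = i then 1 else 0)) \<and>
       (\<forall>c. (\<Sum>r<n. M r c) = (if c = j then 1 else 0))"
      using reachable_balance[OF En, of i, where 'a = 'a] by blast
    show ?case
    proof (cases "j \<in> K")
      case False
      \<comment> \<open>\<open>t\<close> is the factor missing at \<open>(i, j)\<close>. Rows in
        \<open>R\<close> are multiplied and columns in \<open>K\<close> divided by it: on
        \<open>E\<close> both or neither happens, whereas at \<open>(i, j)\<close> only the row is
        affected.\<close>
      define t where "t = q i j / (x i * p i j * y j)"
      have t: "t \<noteq> 0" using ij xy by (auto simp: t_def)
      show ?thesis
        using xy t R False ij eq RK
        by (intro exI[of _ "\<lambda>r. if r \<in> R then t * x r else x r"]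
            exI[of _ "\<lambda>c. if c \<in> K then y c / t else y c"]) (auto simp: e t_def field_simps)
    next
      case True
      obtain M :: "nat \<Rightarrow> nat \<Rightarrow> 'a" where M: "\<And>r c. M r c \<noteq> 0 \<Longrightarrow> (r, c) \<in> E"
        and rows: "\<And>r. (\<Sum>c<n. M r c) = (if r = i then 1 else 0)"
        and cols: "\<And>c. (\<Sum>r<n. M r c) = (if c = j then 1 else 0)"
        using bspec[OF reach True] by blast
      \<comment> \<open>As \<open>e\<close> is new, the separate value of \<open>C\<close> at
        \<open>(i, j)\<close> below overrides no weight coming from \<open>M\<close>.\<close>
      have Mij: "M i j = 0" using M notE by blast
      \<comment> \<open>After rescaling, the weights make \<open>q\<close> a circulation on \<open>E \<union> {e}\<close>, and make \<open>p\<close> differ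
        from this circulation at most at \<open>e\<close>.\<close>
      define C where "C r c = (if (r, c) = (i, j) then - 1 / q i j else M r c / q r c)" for r c
      define P where "P = mat n n (\<lambda>(r, c). C r c * p r c)"
      define Q where "Q = mat n n (\<lambda>(r, c). C r c * q r c)"
      \<comment> \<open>At \<open>(i, j)\<close> the matrix \<open>Q\<close> has entry
        \<open>-1\<close> and the rescaled \<open>P\<close> has
        \<open>- x i * p i j * y j / q i j\<close>; \<open>d\<close> is the difference.\<close>
      define d where "d = 1 - x i * p i j * y j / q i j"
      have DPD: "mat_diag n f * P * mat_diag n g = mat n n (\<lambda>(r, c). f r * P $$ (r, c) * g c)" for f g
        by (rule mat_diag_mult_mat_diag) (simp add: P_def)
      have q0: "q r c \<noteq> 0" if "(r, c) \<in> E" for r c using that insert by auto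
      have Qe: "Q $$ (r, c) = M r c - (if r = i then if c = j then 1 else 0 else 0)" if "r < n" "c < n" for r c
        using that M[of r c] q0[of r c] ij Mij by (cases "M r c = 0") (auto simp: Q_def C_def)
      have DP: "mat_diag n x * P * mat_diag n y = Q + mat n n (\<lambda>rc. if rc = (i, j) then d else 0)"
      proof (rule eq_matI)
        fix r c assume "r < dim_row (Q + mat n n (\<lambda>rc. if rc = (i, j) then d else 0))"
          "c < dim_col (Q + mat n n (\<lambda>rc. if rc = (i, j) then d else 0))"
        then have rc: "r < n" "c < n" by (auto simp: Q_def)
        show "(mat_diag n x * P * mat_diag n y) $$ (r, c) = (Q + mat n n (\<lambda>rc. if rc = (i, j) then d else 0)) $$ (r, c)"
        proof (cases "(r, c) = (i, j)")
          case True
          then show ?thesis unfolding DPD using rc ij by (simp add: P_def Q_def C_def d_def)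
        next
          case False
          show ?thesis
          proof (cases "M r c = 0")
            case True
            then show ?thesis unfolding DPD using rc False by (auto simp: P_def Q_def C_def)
          next
            case nz: False
            have "(mat_diag n x * P * mat_diag n y) $$ (r, c) = x r * (M r c / q r c * p r c) * y c"
              unfolding DPD using rc False by (auto simp: P_def C_def)
            also have "\<dots> = M r c"
              using eq[OF M[OF nz]] q0[OF M[OF nz]] by (simp add: field_simps)
            also have "\<dots> = (Q + mat n n (\<lambda>rc. if rc = (i, j) then d else 0)) $$ (r, c)"
              using rc False q0[OF M[OF nz]] by (auto simp: Q_def C_def)
            finally show ?thesis .
          qed
        qed
      qed (auto simp: Q_def mat_diag_def)
      have "vec_space.rank n (mat_diag n x * P * mat_diag n y) = vec_space.rank n P"
        by (intro rank_mult_invertible[OF _ mat_diag_dim mat_diag_dim mat_diag_inverse(2)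
              mat_diag_dim mat_diag_dim mat_diag_inverse(1)] xy) (simp add: P_def)
      also have "\<dots> = vec_space.rank n Q" unfolding P_def Q_def by (rule rank)
      finally have same: "vec_space.rank n (Q + mat n n (\<lambda>rc. if rc = (i, j) then d else 0)) = vec_space.rank n Q"
        unfolding DP .
      have "d = 0"
      proof (rule ccontr)
        assume "d \<noteq> 0"
        \<comment> \<open>The sums of \<open>M\<close> are \<open>1\<close> in row \<open>i\<close>
          and in column \<open>j\<close> and zero elsewhere; the entry \<open>-1\<close> of
          \<open>Q\<close> at \<open>(i, j)\<close> cancels both.\<close>
        moreover have "(\<Sum>c<n. Q $$ (r, c)) = 0" if "r < n" for r
          using that ij rows[of r] by (simp add: Qe sum_subtractf)
        moreover have "(\<Sum>r<n. Q $$ (r, c)) = 0" if "c < n" for c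
          using that ij cols[of c] by (simp add: Qe sum_subtractf)
        ultimately show False
          using rank_add_unit_neq[of Q n i j d] ij same by (simp add: Q_def)
      qed
      then have "q i j = x i * p i j * y j" using ij by (simp add: d_def field_simps)
      then show ?thesis using xy eq by (intro exI[of _ x] exI[of _ y]) (auto simp: e)
    qed
  qed
  then show ?thesis using that by blast
qed

section \<open>Generic matrices and their evaluations\<close>

lemma poly_mapping_eq_sum_single:
  "p = (\<Sum>u\<in>Poly_Mapping.keys p. Poly_Mapping.single u (Poly_Mapping.lookup p u))"
proof (rule poly_mapping_eqI)
  fix k
  have "(\<Sum>u\<in>Poly_Mapping.keys p. Poly_Mapping.lookup (Poly_Mapping.single u (Poly_Mapping.lookup p u)) k) =
      (\<Sum>u\<in>Poly_Mapping.keys p. if u = k then Poly_Mapping.lookup p u else 0)"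
    by (intro sum.cong) (auto simp: lookup_single when_def)
  also have "\<dots> = Poly_Mapping.lookup p k"
    by (simp add: sum.delta in_keys_iff)
  finally show "Poly_Mapping.lookup p k =
      Poly_Mapping.lookup (\<Sum>u\<in>Poly_Mapping.keys p. Poly_Mapping.single u (Poly_Mapping.lookup p u)) k"
    by (simp add: lookup_sum)
qed

definition monom_eval :: "('v \<Rightarrow> 'a) \<Rightarrow> ('v \<Rightarrow>\<^sub>0 nat) \<Rightarrow> 'a :: comm_semiring_1" where
  "monom_eval a u = (\<Prod>v\<in>Poly_Mapping.keys u. a v ^ Poly_Mapping.lookup u v)"

text \<open>Variables outside the keys contribute \<open>a v ^ 0 = 1\<close>, so several monomials
  can be evaluated over a common set of variables.\<close>

lemma monom_eval_superset:
  assumes "finite S" "Poly_Mapping.keys u \<subseteq> S"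
  shows "monom_eval a u = (\<Prod>v\<in>S. a v ^ Poly_Mapping.lookup u v)"
  unfolding monom_eval_def using assms by (intro prod.mono_neutral_left) (auto simp: in_keys_iff)

lemma monom_eval_add: "monom_eval a (u + w) = monom_eval a u * monom_eval a w"
proof -
  let ?S = "Poly_Mapping.keys u \<union> Poly_Mapping.keys w"
  have "monom_eval a (u + w) = (\<Prod>v\<in>?S. a v ^ Poly_Mapping.lookup (u + w) v)"
    by (rule monom_eval_superset) (auto simp: keys_add)
  also have "\<dots> = (\<Prod>v\<in>?S. a v ^ Poly_Mapping.lookup u v) * (\<Prod>v\<in>?S. a v ^ Poly_Mapping.lookup w v)"
    by (simp add: lookup_add power_add prod.distrib)
  also have "\<dots> = monom_eval a u * monom_eval a w"
    by (simp add: monom_eval_superset[of ?S])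
  finally show ?thesis .
qed

lemma geval_altdef:
  "geval a p = (\<Sum>u\<in>Poly_Mapping.keys p. Poly_Mapping.lookup p u * monom_eval a u)"
  by (simp add: geval_def monom_eval_def)

lemma geval_single: "geval a (Poly_Mapping.single u c) = c * monom_eval a u"
  by (simp add: geval_altdef)

lemma geval_zero: "geval a 0 = 0"
  by (simp add: geval_def)

lemma geval_gconst: "geval a (gconst c) = c"
  by (simp add: gconst_def geval_single monom_eval_def)

lemma geval_gvar: "geval a (gvar v) = a v"
  by (simp add: gvar_def geval_single monom_eval_def)

lemma geval_add: "geval a (p + q) = geval a p + geval a q"
  unfolding geval_altdef
  by (rule setsum_keys_plus_distrib) (simp_all add: distrib_right)

lemma geval_sum: "geval a (\<Sum>x\<in>S. f x) = (\<Sum>x\<in>S. geval a (f x))"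
  by (induction S rule: infinite_finite_induct) (simp_all add: geval_zero geval_add)

lemma geval_mult: "geval a (p * q) = geval a p * geval a q"
proof -
  have "p * q = (\<Sum>u\<in>Poly_Mapping.keys p. \<Sum>w\<in>Poly_Mapping.keys q.
      Poly_Mapping.single (u + w) (Poly_Mapping.lookup p u * Poly_Mapping.lookup q w))"
    by (subst poly_mapping_eq_sum_single[of p], subst poly_mapping_eq_sum_single[of q])
      (simp only: sum_product mult_single)
  then have "geval a (p * q) = (\<Sum>u\<in>Poly_Mapping.keys p. \<Sum>w\<in>Poly_Mapping.keys q.
      (Poly_Mapping.lookup p u * monom_eval a u) * (Poly_Mapping.lookup q w * monom_eval a w))"
    by (simp add: geval_sum geval_single monom_eval_add mult_ac)
  then show ?thesis unfolding geval_altdef sum_product .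
qed

text \<open>Lifted entrywise to matrices, this makes \<open>gsubst\<close> multiplicative.\<close>

lemma semiring_hom_geval: "semiring_hom (geval a)"
proof
  show "geval a 1 = 1" using geval_gconst[of a 1] by (simp add: gconst_def)
qed (simp_all add: geval_zero geval_add geval_mult)

lemma generic_alg_carrier: "F \<in> generic_alg n m \<Longrightarrow> F \<in> carrier_mat n n"
  by (induction rule: generic_alg.induct) (auto simp: generic_mat_def)

lemma gsubst_carrier: "F \<in> carrier_mat n n \<Longrightarrow> gsubst As F \<in> carrier_mat n n"
  by (simp add: gsubst_def)

lemma gsubst_mult:
  assumes "F \<in> carrier_mat n n" "G \<in> carrier_mat n n"
  shows "gsubst As (F * G) = gsubst As F * gsubst As G"
  unfolding gsubst_def using semiring_hom.mat_hom_mult[OF semiring_hom_geval assms] .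

lemma gsubst_one: "gsubst As (1\<^sub>m n) = 1\<^sub>m n"
  unfolding gsubst_def using semiring_hom.mat_hom_one[OF semiring_hom_geval] .

lemma gsubst_add:
  assumes "F \<in> carrier_mat n n" "G \<in> carrier_mat n n"
  shows "gsubst As (F + G) = gsubst As F + gsubst As G"
  using assms by (intro eq_matI) (auto simp: gsubst_def geval_add)

lemma gsubst_smult: "gsubst As (gconst c \<cdot>\<^sub>m F) = c \<cdot>\<^sub>m gsubst As F"
  by (intro eq_matI) (auto simp: gsubst_def geval_mult geval_gconst)

lemma gsubst_generic_mat:
  assumes "As ! k \<in> carrier_mat n n"
  shows "gsubst As (generic_mat n k) = As ! k"
  using assms by (intro eq_matI) (auto simp: gsubst_def generic_mat_def geval_gvar)

lemma mat_tuples_nth: "As \<in> mat_tuples n m \<Longrightarrow> k < m \<Longrightarrow> As ! k \<in> carrier_mat n n"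
  by (auto simp: mat_tuples_def)

section \<open>Words in matrices and their linear combinations\<close>

definition word_mat :: "nat \<Rightarrow> 'a :: semiring_1 mat list \<Rightarrow> nat list \<Rightarrow> 'a mat" where
  "word_mat n As w = foldr (\<lambda>k M. As ! k * M) w (1\<^sub>m n)"

lemma word_mat_carrier:
  assumes "As \<in> mat_tuples n m" "set w \<subseteq> {..<m}"
  shows "word_mat n As w \<in> carrier_mat n n"
  using assms(2) mat_tuples_nth[OF assms(1)] by (induction w) (auto simp: word_mat_def intro!: mult_carrier_mat)

lemma generic_word_in_generic_alg: "set w \<subseteq> {..<m} \<Longrightarrow> generic_word n w \<in> generic_alg n m"
  by (induction w) (auto simp: generic_word_def intro: generic_alg.intros)

lemma gsubst_generic_word:
  fixes As :: "'a :: field mat list"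
  assumes As: "As \<in> mat_tuples n m" and w: "set w \<subseteq> {..<m}"
  shows "gsubst As (generic_word n w) = word_mat n As w"
  using w
proof (induction w)
  case Nil
  show ?case by (simp add: generic_word_def word_mat_def gsubst_one)
next
  case (Cons k w)
  then have "(generic_word n w :: 'a gpoly mat) \<in> carrier_mat n n" "As ! k \<in> carrier_mat n n"
    using generic_alg_carrier[OF generic_word_in_generic_alg[of w m n]] mat_tuples_nth[OF As] by auto
  moreover have "(generic_mat n k :: 'a gpoly mat) \<in> carrier_mat n n" by (simp add: generic_mat_def)
  ultimately show ?case
    using Cons by (simp add: generic_word_def word_mat_def gsubst_mult[of _ n] gsubst_generic_mat)
qed

lemma nc_eval_generic_in_generic_alg:
  fixes f :: "'a :: field ncpoly"
  assumes f: "f \<in> nc_letters m"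
  shows "nc_eval_generic n f \<in> generic_alg n m"
proof -
  \<comment> \<open>Generalised from the keys and coefficients of \<open>f\<close> to any finite set
    and any coefficients, so that words can be added one by one.\<close>
  have "mat n n (\<lambda>ij. \<Sum>w\<in>W. gconst (c w) * generic_word n w $$ ij) \<in> generic_alg n m"
    if "finite W" "\<forall>w\<in>W. set w \<subseteq> {..<m}" for W and c :: "nat list \<Rightarrow> 'a"
    using that
  proof (induction W rule: finite_induct)
    case empty
    \<comment> \<open>The zero matrix is not among the generators; it arises as the scalar multiple
      \<open>0\<close> of the identity.\<close>
    have "mat n n (\<lambda>ij. 0) = gconst (0 :: 'a) \<cdot>\<^sub>m 1\<^sub>m n"
      by (intro eq_matI) (auto simp: gconst_def)
    then show ?case by (simp add: generic_alg.intros)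
  next
    case (insert w W)
    have G: "(generic_word n w :: 'a gpoly mat) \<in> generic_alg n m" using insert by (intro generic_word_in_generic_alg) auto
    have "mat n n (\<lambda>ij. \<Sum>w\<in>insert w W. gconst (c w) * generic_word n w $$ ij) =
        gconst (c w) \<cdot>\<^sub>m generic_word n w + mat n n (\<lambda>ij. \<Sum>w\<in>W. gconst (c w) * generic_word n w $$ ij)"
      using insert carrier_matD[OF generic_alg_carrier[OF G]] by (intro eq_matI) auto
    then show ?case using insert G by (auto intro: generic_alg.intros)
  qed
  then show ?thesis using f unfolding nc_eval_generic_def nc_letters_def by auto
qed

lemma generic_deg_nc_eval_le:
  assumes "f \<in> nc_letters m"
  shows "generic_deg n m (nc_eval_generic n f) \<le> nc_degree f"
  unfolding generic_deg_def using assms by (intro Least_le) auto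

lemma keys_sum_single_subset:
  "Poly_Mapping.keys (\<Sum>x\<in>X. Poly_Mapping.single (u x) (c x)) \<subseteq> u ` X"
proof (induction X rule: infinite_finite_induct)
  case (insert x X)
  then show ?case
    using keys_add[of "Poly_Mapping.single (u x) (c x)" "\<Sum>x\<in>X. Poly_Mapping.single (u x) (c x)"]
    by (auto split: if_splits)
qed auto

lemma sum_keys_sum_single:
  fixes u :: "'x \<Rightarrow> 'w" and c :: "'x \<Rightarrow> 'a :: comm_semiring_1"
  defines "f \<equiv> \<lambda>X. \<Sum>x\<in>X. Poly_Mapping.single (u x) (c x)"
  shows "(\<Sum>w\<in>Poly_Mapping.keys (f X). Poly_Mapping.lookup (f X) w * g w) = (\<Sum>x\<in>X. c x * g (u x))"
proof (induction X rule: infinite_finite_induct)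
  case (insert x X)
  have "f (insert x X) = Poly_Mapping.single (u x) (c x) + f X"
    using insert by (simp add: f_def)
  then show ?case
    using insert setsum_keys_plus_distrib[of "\<lambda>w a. a * g w" "Poly_Mapping.single (u x) (c x)" "f X"]
    by (simp add: distrib_right)
qed (simp_all add: f_def)

text \<open>\<open>F\<close> is the image of a non-commutative polynomial with the given words,
  whose lengths bound its degree. It is chosen before the tuple, so that one \<open>F\<close> can be
  evaluated at two different pairs.\<close>

lemma generic_alg_linear_comb:
  fixes c :: "'x \<Rightarrow> 'a :: field"
  assumes letters: "\<And>x. x \<in> X \<Longrightarrow> set (u x) \<subseteq> {..<m}" and len: "\<And>x. x \<in> X \<Longrightarrow> length (u x) \<le> d"
  obtains F where "F \<in> generic_alg n m" "generic_deg n m F \<le> d"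
    "\<And>As. As \<in> mat_tuples n m \<Longrightarrow> gsubst As F = mat n n (\<lambda>ij. \<Sum>x\<in>X. c x * word_mat n As (u x) $$ ij)"
proof -
  define f where "f = (\<Sum>x\<in>X. Poly_Mapping.single (u x) (c x))"
  have keys: "Poly_Mapping.keys f \<subseteq> u ` X" unfolding f_def by (rule keys_sum_single_subset)
  have f: "f \<in> nc_letters m" using keys letters by (auto simp: nc_letters_def)
  have "nc_degree f \<le> d" unfolding nc_degree_def using keys len by auto
  then have "generic_deg n m (nc_eval_generic n f) \<le> d"
    using generic_deg_nc_eval_le[OF f, of n] by simp
  moreover have "gsubst As (nc_eval_generic n f) = mat n n (\<lambda>ij. \<Sum>x\<in>X. c x * word_mat n As (u x) $$ ij)"
    if As: "As \<in> mat_tuples n m" for As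
  proof (rule eq_matI)
    fix i j assume "i < dim_row (mat n n (\<lambda>ij. \<Sum>x\<in>X. c x * word_mat n As (u x) $$ ij))"
      "j < dim_col (mat n n (\<lambda>ij. \<Sum>x\<in>X. c x * word_mat n As (u x) $$ ij))"
    then have ij: "i < n" "j < n" by auto
    let ?e = "geval (\<lambda>(i, j, k). (As ! k) $$ (i, j))"
    have word: "?e (generic_word n w $$ (i, j)) = word_mat n As w $$ (i, j)"
      if "w \<in> Poly_Mapping.keys f" for w
    proof -
      have w: "set w \<subseteq> {..<m}" using that keys letters by auto
      show ?thesis
        using gsubst_generic_word[OF As w] generic_alg_carrier[OF generic_word_in_generic_alg[OF w], of n, where 'a = 'a] ij
        by (metis carrier_matD gsubst_def index_map_mat(1))
    qed
    have "gsubst As (nc_eval_generic n f) $$ (i, j) =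
        (\<Sum>w\<in>Poly_Mapping.keys f. Poly_Mapping.lookup f w * word_mat n As w $$ (i, j))"
      using ij word
      by (auto simp: gsubst_def nc_eval_generic_def geval_sum geval_mult geval_gconst intro!: sum.cong)
    also have "\<dots> = (\<Sum>x\<in>X. c x * word_mat n As (u x) $$ (i, j))"
      unfolding f_def by (rule sum_keys_sum_single)
    finally show "gsubst As (nc_eval_generic n f) $$ (i, j) =
        mat n n (\<lambda>ij. \<Sum>x\<in>X. c x * word_mat n As (u x) $$ ij) $$ (i, j)" using ij by simp
  qed (auto simp: gsubst_def nc_eval_generic_def)
  ultimately show ?thesis using that nc_eval_generic_in_generic_alg[OF f] by blast
qed

section \<open>Conjugation, invariance and width of the rank functions\<close>

lemma GL_iff:
  "g \<in> GL n \<longleftrightarrow> g \<in> carrier_mat n n \<and> (\<exists>h\<in>carrier_mat n n. g * h = 1\<^sub>m n \<and> h * g = 1\<^sub>m n)"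
  by (auto simp: GL_def Units_def ring_mat_def)

text \<open>Inverses in the matrix ring are unique, so an explicit two-sided inverse can replace the
  one in the definition.\<close>

lemma conj_act_eq:
  assumes g: "g \<in> carrier_mat n n" and h: "h \<in> carrier_mat n n" and gh: "g * h = 1\<^sub>m n" "h * g = 1\<^sub>m n"
  shows "conj_act n g As = map (\<lambda>A. g * A * h) As"
proof -
  interpret ring "ring_mat TYPE('a) n ()" by (rule ring_mat)
  have "h = inv\<^bsub>ring_mat TYPE('a) n ()\<^esub> g"
    using assms by (intro inv_unique') (auto simp: ring_mat_simps)
  then show ?thesis by (simp add: conj_act_def)
qed

text \<open>Evaluation commutes with conjugation on the generators, and each operation preserves
  this; in products the inner \<open>h * g\<close> cancels.\<close>

lemma gsubst_conj:
  fixes As :: "'a :: field mat list"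
  assumes F: "F \<in> generic_alg n m" and As: "As \<in> mat_tuples n m"
    and g: "g \<in> carrier_mat n n" and h: "h \<in> carrier_mat n n" and gh: "g * h = 1\<^sub>m n" "h * g = 1\<^sub>m n"
  shows "gsubst (map (\<lambda>A. g * A * h) As) F = g * gsubst As F * h"
  using F
proof (induction rule: generic_alg.induct)
  case one
  show ?case using g h gh by (simp add: gsubst_one)
next
  case (gen k)
  then have "As ! k \<in> carrier_mat n n" "k < length As" using As by (auto simp: mat_tuples_def)
  then show ?case using g h by (simp add: gsubst_generic_mat)
next
  case (add F G)
  have "gsubst As F \<in> carrier_mat n n" "gsubst As G \<in> carrier_mat n n"
    using add generic_alg_carrier gsubst_carrier by blast+
  then have "g * (gsubst As F + gsubst As G) * h = g * gsubst As F * h + g * gsubst As G * h"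
    using g h by (simp add: mult_add_distrib_mat[OF g] add_mult_distrib_mat[of _ n n _ h n])
  then show ?case using add generic_alg_carrier[of F] generic_alg_carrier[of G]
    by (simp add: gsubst_add[of _ n])
next
  case (mult F G)
  let ?F = "gsubst As F" and ?G = "gsubst As G"
  have c: "?F \<in> carrier_mat n n" "?G \<in> carrier_mat n n"
    using mult generic_alg_carrier gsubst_carrier by blast+
  have "g * ?F * h * (g * ?G * h) = g * ?F * (h * (g * (?G * h)))"
    using g h c by (simp add: assoc_mult_mat[of _ n n _ n _ n])
  also have "h * (g * (?G * h)) = (h * g) * (?G * h)"
    using g h c by (simp add: assoc_mult_mat[of _ n n _ n _ n])
  also have "g * ?F * \<dots> = g * (?F * ?G) * h"
    using g h c gh by (simp add: assoc_mult_mat[of _ n n _ n _ n])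
  finally show ?case using mult generic_alg_carrier[of F] generic_alg_carrier[of G]
    by (simp add: gsubst_mult[of _ n])
next
  case (smult F c)
  have "gsubst As F \<in> carrier_mat n n"
    using smult generic_alg_carrier gsubst_carrier by blast
  then show ?case using smult g h
    by (simp add: gsubst_smult mult_smult_distrib[of _ n n _ n] mult_smult_assoc_mat[of _ n n _ n])
qed

lemma rank_ind_conj:
  assumes "A \<in> carrier_mat n n" "g \<in> carrier_mat n n" "h \<in> carrier_mat n n" "g * h = 1\<^sub>m n" "h * g = 1\<^sub>m n"
  shows "rank_ind n t (g * A * h) = rank_ind n t A"
  using rank_mult_invertible[OF assms(1,2,3,5,3,2,5)] by (simp add: rank_ind_def)

lemma rank_inv_invariant:
  assumes F: "F \<in> generic_alg n m"
  shows "rank_inv n t F \<in> abstract_invariants n m"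
  unfolding abstract_invariants_def mem_Collect_eq
proof (intro ballI)
  fix As :: "'a mat list" and g :: "'a mat"
  assume As: "As \<in> mat_tuples n m" and "g \<in> GL n"
  then obtain h where gh: "g \<in> carrier_mat n n" "h \<in> carrier_mat n n" "g * h = 1\<^sub>m n" "h * g = 1\<^sub>m n"
    unfolding GL_iff by blast
  show "rank_inv n t F (conj_act n g As) = rank_inv n t F As"
    unfolding rank_inv_def conj_act_eq[OF gh] gsubst_conj[OF F As gh]
    using gsubst_carrier[OF generic_alg_carrier[OF F]] gh by (rule rank_ind_conj)
qed

text \<open>The least positive value is attained by the one-element list \<open>[F]\<close> together
  with the rank indicator of the only entry of a tuple of length one.\<close>

lemma width_rank_inv:
  fixes F :: "'a :: field gpoly mat"
  assumes F: "F \<in> generic_alg n m"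
  shows "width n m (rank_inv n t F) = 1"
  unfolding width_def
proof (rule Least_equality)
  let ?h = "\<lambda>As :: 'a mat list. rank_ind n t (hd As)"
  have "?h \<in> abstract_invariants n 1"
    unfolding abstract_invariants_def mem_Collect_eq
  proof (intro ballI)
    fix As :: "'a mat list" and g :: "'a mat"
    assume "As \<in> mat_tuples n 1" and "g \<in> GL n"
    then obtain A h where As: "As = [A]" "A \<in> carrier_mat n n"
      and gh: "g \<in> carrier_mat n n" "h \<in> carrier_mat n n" "g * h = 1\<^sub>m n" "h * g = 1\<^sub>m n"
      unfolding GL_iff by (auto simp: mat_tuples_def length_Suc_conv)
    show "?h (conj_act n g As) = ?h As"
      unfolding conj_act_eq[OF gh] using rank_ind_conj[OF As(2) gh] As by simp
  qed
  then show "1 > (0 :: nat) \<and> (\<exists>h\<in>abstract_invariants n 1. \<exists>Fs. length Fs = 1 \<and> set Fs \<subseteq> generic_alg n m \<and>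
        (\<forall>As\<in>mat_tuples n m. rank_inv n t F As = h (map (gsubst As) Fs)))"
    using F by (auto simp: rank_inv_def intro!: bexI[of _ ?h] exI[of _ "[F]"])
qed auto

section \<open>Pairs whose first matrix has distinct eigenvalues\<close>

text \<open>\<open>l i\<close> lists the coefficients of the Lagrange polynomial that is
  \<open>1\<close> at \<open>e i\<close> and \<open>0\<close> at the other nodes. It is a multiple
  of a product of \<open>n - 1\<close> linear factors, so \<open>n\<close> coefficients
  suffice.\<close>

lemma lagrange_basis:
  fixes e :: "nat \<Rightarrow> 'a :: field"
  assumes inj: "inj_on e {..<n}"
  shows "\<exists>l. \<forall>i<n. \<forall>j<n. (\<Sum>k<n. l i k * e j ^ k) = (if i = j then 1 else 0)"
proof -
  define p where "p i = (\<Prod>j\<in>{..<n} - {i}. [:- e j, 1:])" for i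
  have root: "poly (p i) (e j) = 0 \<longleftrightarrow> i \<noteq> j" if "i < n" "j < n" for i j
    using that inj by (auto simp: p_def poly_prod inj_on_def)
  have deg: "degree (p i) < n" if "i < n" for i
  proof -
    have "degree (p i) = (\<Sum>j\<in>{..<n} - {i}. degree [:- e j, 1:])"
      unfolding p_def by (rule degree_prod_eq_sum_degree) auto
    then show ?thesis using that by simp
  qed
  have "(\<Sum>k<n. coeff (p i) k / poly (p i) (e i) * e j ^ k) = (if i = j then 1 else 0)"
    if "i < n" "j < n" for i j
  proof -
    have "poly (p i) (e j) = (\<Sum>k<n. coeff (p i) k * e j ^ k)"
      unfolding poly_altdef using deg[OF that(1)]
      by (intro sum.mono_neutral_left) (auto simp: coeff_eq_0)
    then show ?thesis using root[OF that] root[OF that(1) that(1)]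
      by (auto simp flip: sum_divide_distrib)
  qed
  then show ?thesis by (intro exI[of _ "\<lambda>i k. coeff (p i) k / poly (p i) (e i)"]) auto
qed

text \<open>The eigenvectors form the columns of \<open>V\<close>, so that
  \<open>A * V = V * mat_diag n e\<close>; it remains to see that they are independent.\<close>

lemma diagonalizable_if_distinct_eigenvalues:
  fixes A :: "'a :: field mat"
  assumes A: "A \<in> carrier_mat n n" and inj: "inj_on e {..<n}"
    and ev: "\<And>i. i < n \<Longrightarrow> eigenvalue A (e i)"
  obtains g h where "g \<in> carrier_mat n n" "h \<in> carrier_mat n n" "g * h = 1\<^sub>m n" "h * g = 1\<^sub>m n"
    "g * A * h = mat_diag n e"
proof -
  obtain v where "\<And>i. i < n \<Longrightarrow> eigenvector A (v i) (e i)"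
    using ev unfolding eigenvalue_def by metis
  then have v: "v i \<in> carrier_vec n" "v i \<noteq> 0\<^sub>v n" "A *\<^sub>v v i = e i \<cdot>\<^sub>v v i" if "i < n" for i
    using that A by (auto simp: eigenvector_def)
  have Av: "(\<Sum>s<n. A $$ (r, s) * v c $ s) = e c * v c $ r" if "r < n" "c < n" for r c
    using arg_cong[OF v(3)[OF that(2)], of "\<lambda>w. w $ r"] v(1)[OF that(2)] that A
    by (simp add: scalar_prod_def lessThan_atLeast0)
  define V where "V = mat n n (\<lambda>(r, c). v c $ r)"
  have V: "V \<in> carrier_mat n n" by (simp add: V_def)
  have AV: "A * V = V * mat_diag n e"
  proof (rule eq_matI)
    fix r c assume "r < dim_row (V * mat_diag n e)" "c < dim_col (V * mat_diag n e)"
    then have rc: "r < n" "c < n" by (auto simp: V_def mat_diag_def)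
    have "(A * V) $$ (r, c) = (\<Sum>s<n. A $$ (r, s) * v c $ s)"
      using rc A by (simp add: V_def scalar_prod_def lessThan_atLeast0)
    also have "\<dots> = (V * mat_diag n e) $$ (r, c)"
      unfolding mat_diag_mult_right[OF V] using Av[OF rc] rc by (simp add: V_def mult.commute)
    finally show "(A * V) $$ (r, c) = (V * mat_diag n e) $$ (r, c)" .
  qed (use A in \<open>auto simp: V_def mat_diag_def\<close>)
  have "det V \<noteq> 0"
  proof
    assume "det V = 0"
    then obtain x where x: "x \<in> carrier_vec n" "x \<noteq> 0\<^sub>v n" and Vx: "V *\<^sub>v x = 0\<^sub>v n"
      unfolding det_0_iff_vec_prod_zero_field[OF V] by blast
    \<comment> \<open>In coordinates, this is \<open>V *\<^sub>v x = 0\<close> multiplied by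
      \<open>A\<close> from the left \<open>k\<close> times.\<close>
    have power: "(\<Sum>c<n. v c $ r * e c ^ k * x $ c) = 0" if "r < n" for k r
      using that
    proof (induction k arbitrary: r)
      case 0
      then show ?case using arg_cong[OF Vx, of "\<lambda>w. w $ r"] x(1)
        by (simp add: V_def scalar_prod_def lessThan_atLeast0)
    next
      case (Suc k)
      have "(\<Sum>c<n. v c $ r * e c ^ Suc k * x $ c) = (\<Sum>c<n. (\<Sum>s<n. A $$ (r, s) * v c $ s) * (e c ^ k * x $ c))"
        using Suc.prems by (intro sum.cong) (simp_all add: Av)
      also have "\<dots> = (\<Sum>s<n. A $$ (r, s) * (\<Sum>c<n. v c $ s * e c ^ k * x $ c))"
        unfolding sum_distrib_left sum_distrib_right by (subst sum.swap) (simp add: mult_ac)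
      finally show ?case using Suc.IH by simp
    qed
    obtain l where l: "\<And>i j. i < n \<Longrightarrow> j < n \<Longrightarrow> (\<Sum>k<n. l i k * e j ^ k) = (if i = j then 1 else 0)"
      using lagrange_basis[OF inj] by blast
    have "v i $ r * x $ i = 0" if "i < n" "r < n" for i r
    proof -
      \<comment> \<open>Weighting the powers by a Lagrange polynomial isolates the summand of a
        single eigenvector.\<close>
      have "0 = (\<Sum>k<n. l i k * (\<Sum>c<n. v c $ r * e c ^ k * x $ c))"
        using power[OF that(2)] by simp
      also have "\<dots> = (\<Sum>c<n. (\<Sum>k<n. l i k * e c ^ k) * (v c $ r * x $ c))"
        unfolding sum_distrib_left sum_distrib_right by (subst sum.swap) (simp add: mult_ac)
      also have "\<dots> = (\<Sum>c<n. if c = i then v c $ r * x $ c else 0)"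
        using l that by (intro sum.cong) auto
      also have "\<dots> = v i $ r * x $ i" using that by simp
      finally show ?thesis by simp
    qed
    moreover have "\<exists>r<n. v i $ r \<noteq> 0" if "i < n" for i
      using v(1,2)[OF that] by (metis carrier_vecD dim_vec eq_vecI index_zero_vec)
    ultimately have "x $ i = 0" if "i < n" for i using that by fastforce
    then have "x = 0\<^sub>v n" using x(1) by (intro eq_vecI) auto
    then show False using x(2) by simp
  qed
  then obtain g where g: "g \<in> carrier_mat n n" "g * V = 1\<^sub>m n" "V * g = 1\<^sub>m n"
    using det_non_zero_imp_unit[OF V, of "()"] by (auto simp: Units_def ring_mat_def)
  have "g * A * V = g * V * mat_diag n e"
    using g(1) A V AV by (simp add: assoc_mult_mat[of _ n n _ n _ n])
  then show ?thesis using that[OF g(1) V g(2,3)] g by (simp add: left_mult_one_mat[OF mat_diag_dim])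
qed

section \<open>Interpolation by words at a diagonal first matrix\<close>

lemma word_mat_letter0_index:
  fixes P :: "'a :: comm_semiring_1 mat"
  assumes P: "P \<in> carrier_mat n n" and w: "set w \<subseteq> {..<2}" and ij: "i < n" "j < n"
  shows "word_mat n [mat_diag n e, P] (replicate a 0 @ w) $$ (i, j) = e i ^ a * word_mat n [mat_diag n e, P] w $$ (i, j)"
proof (induction a)
  case (Suc a)
  have "word_mat n [mat_diag n e, P] (replicate a 0 @ w) \<in> carrier_mat n n"
    using P w by (intro word_mat_carrier[where m = 2]) (auto simp: mat_tuples_def)
  then show ?case using Suc ij
    by (simp add: word_mat_def mat_diag_mult_left mult_ac del: index_mult_mat(1))
qed simp

lemma word_mat_power_index:
  fixes P :: "'a :: comm_semiring_1 mat"
  assumes P: "P \<in> carrier_mat n n" and ij: "i < n" "j < n"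
  shows "word_mat n [mat_diag n e, P] (replicate a 0) $$ (i, j) = (if i = j then e i ^ a else 0)"
  using word_mat_letter0_index[OF P, of "[]" i j e a] ij by (simp add: word_mat_def)

lemma word_mat_sandwich_index:
  fixes P :: "'a :: comm_semiring_1 mat"
  assumes P: "P \<in> carrier_mat n n" and ij: "i < n" "j < n"
  shows "word_mat n [mat_diag n e, P] (replicate a 0 @ 1 # replicate b 0) $$ (i, j) = e i ^ a * P $$ (i, j) * e j ^ b"
proof -
  have "word_mat n [mat_diag n e, P] (replicate b 0) = mat_diag n (\<lambda>i. e i ^ b)"
  proof (rule eq_matI)
    have "word_mat n [mat_diag n e, P] (replicate b 0) \<in> carrier_mat n n"
      using P by (intro word_mat_carrier[where m = 2]) (auto simp: mat_tuples_def)
    then show "dim_row (word_mat n [mat_diag n e, P] (replicate b 0)) = dim_row (mat_diag n (\<lambda>i. e i ^ b))"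
      "dim_col (word_mat n [mat_diag n e, P] (replicate b 0)) = dim_col (mat_diag n (\<lambda>i. e i ^ b))"
      by (auto simp: mat_diag_def)
  qed (use word_mat_power_index[OF P] in \<open>auto simp: mat_diag_def\<close>)
  then have "word_mat n [mat_diag n e, P] (1 # replicate b 0) = P * mat_diag n (\<lambda>i. e i ^ b)"
    by (simp add: word_mat_def)
  moreover have "set (1 # replicate b (0 :: nat)) \<subseteq> {..<2}" by auto
  ultimately show ?thesis
    using word_mat_letter0_index[OF P _ ij, of "1 # replicate b 0" e a] ij
    by (simp add: mat_diag_mult_right[OF P] mult_ac)
qed

text \<open>At \<open>mat_diag n e\<close>, the \<open>i\<close>-th Lagrange polynomial gives the
  matrix unit \<open>E_ii\<close>. Hence \<open>F\<close> is the sum of all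
  \<open>\<gamma> i * E_ii\<close> and \<open>C i j * E_ii * X_1 * E_jj\<close>, and its longest
  words have length \<open>(n - 1) + 1 + (n - 1)\<close>.\<close>

lemma generic_alg_interpolation:
  fixes e :: "nat \<Rightarrow> 'a :: field"
  assumes inj: "inj_on e {..<n}"
  obtains F where "F \<in> generic_alg n 2" "generic_deg n 2 F \<le> 2 * n - 1"
    "\<And>P. P \<in> carrier_mat n n \<Longrightarrow>
      gsubst [mat_diag n e, P] F = mat n n (\<lambda>(i, j). (if i = j then \<gamma> i else 0) + C i j * P $$ (i, j))"
proof -
  obtain l where l: "\<And>i j. i < n \<Longrightarrow> j < n \<Longrightarrow> (\<Sum>k<n. l i k * e j ^ k) = (if i = j then 1 else 0)"
    using lagrange_basis[OF inj] by blast
  define u :: "nat + nat \<times> nat \<Rightarrow> nat list" where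
    "u = case_sum (\<lambda>a. replicate a 0) (\<lambda>(a, b). replicate a 0 @ 1 # replicate b 0)"
  \<comment> \<open>These coefficients come from expanding that sum into words: \<open>Inl a\<close>
    stands for \<open>X_0^a\<close>, and \<open>Inr (a, b)\<close> for
    \<open>X_0^a X_1 X_0^b\<close>.\<close>
  define c where "c = case_sum (\<lambda>a. \<Sum>i<n. \<gamma> i * l i a) (\<lambda>(a, b). \<Sum>i<n. \<Sum>j<n. C i j * (l i a * l j b))"
  define X where "X = {..<n} <+> ({..<n} \<times> {..<n})"
  have "set (u x) \<subseteq> {..<2}" "length (u x) \<le> 2 * n - 1" if "x \<in> X" for x
    using that by (auto simp: X_def u_def split: sum.splits)
  then obtain F where F: "F \<in> generic_alg n 2" "generic_deg n 2 F \<le> 2 * n - 1"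
    "\<And>As. As \<in> mat_tuples n 2 \<Longrightarrow> gsubst As F = mat n n (\<lambda>ij. \<Sum>x\<in>X. c x * word_mat n As (u x) $$ ij)"
    using generic_alg_linear_comb[of X u 2 "2 * n - 1" n c] by blast
  have "gsubst [mat_diag n e, P] F = mat n n (\<lambda>(i, j). (if i = j then \<gamma> i else 0) + C i j * P $$ (i, j))"
    if P: "P \<in> carrier_mat n n" for P
  proof -
    have entry: "(\<Sum>x\<in>X. c x * word_mat n [mat_diag n e, P] (u x) $$ (r, s)) =
        (if r = s then \<gamma> r else 0) + C r s * P $$ (r, s)" if rs: "r < n" "s < n" for r s
    proof -
      have "(\<Sum>x\<in>X. c x * word_mat n [mat_diag n e, P] (u x) $$ (r, s)) =
          (\<Sum>a<n. c (Inl a) * (if r = s then e r ^ a else 0)) +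
          (\<Sum>a<n. \<Sum>b<n. c (Inr (a, b)) * (e r ^ a * P $$ (r, s) * e s ^ b))"
        unfolding X_def
        by (simp add: sum.Plus u_def word_mat_power_index[OF P rs] word_mat_sandwich_index[OF P rs, simplified]
            sum.cartesian_product split_def)
      also have "(\<Sum>a<n. c (Inl a) * (if r = s then e r ^ a else 0)) =
          (\<Sum>i<n. \<gamma> i * (\<Sum>a<n. l i a * e r ^ a) * (if r = s then 1 else 0))"
        unfolding c_def sum.case sum_distrib_left sum_distrib_right
        by (subst sum.swap) (auto simp: mult_ac intro!: sum.cong)
      also have "\<dots> = (\<Sum>i<n. if i = r then \<gamma> i * (if r = s then 1 else 0) else 0)"
        using l rs by (intro sum.cong) auto
      also have "\<dots> = (if r = s then \<gamma> r else 0)" using rs by simp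
      also have "(\<Sum>a<n. \<Sum>b<n. c (Inr (a, b)) * (e r ^ a * P $$ (r, s) * e s ^ b)) =
          (\<Sum>a<n. \<Sum>b<n. \<Sum>i<n. \<Sum>j<n. C i j * P $$ (r, s) * (l i a * e r ^ a) * (l j b * e s ^ b))"
        unfolding c_def by (simp add: sum_distrib_left sum_distrib_right mult_ac)
      \<comment> \<open>With the sums over exponents innermost, they factor into two Kronecker
        deltas.\<close>
      also have "\<dots> = (\<Sum>i<n. \<Sum>j<n. \<Sum>a<n. \<Sum>b<n. C i j * P $$ (r, s) * (l i a * e r ^ a) * (l j b * e s ^ b))"
        by (simp only: sum.cartesian_product) (rule sum.reindex_bij_witness[of _ "\<lambda>(i, j, a, b). (a, b, i, j)" "\<lambda>(a, b, i, j). (i, j, a, b)"]; auto)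
      also have "\<dots> = (\<Sum>i<n. \<Sum>j<n. C i j * P $$ (r, s) * (\<Sum>a<n. l i a * e r ^ a) * (\<Sum>b<n. l j b * e s ^ b))"
        by (simp add: sum_distrib_left sum_distrib_right mult_ac)
      also have "\<dots> = (\<Sum>i<n. \<Sum>j<n. if j = s then (if i = r then C i j * P $$ (r, s) else 0) else 0)"
        using l rs by (intro sum.cong) auto
      also have "\<dots> = C r s * P $$ (r, s)" using rs by simp
      finally show ?thesis .
    qed
    have As: "[mat_diag n e, P] \<in> mat_tuples n 2" using P by (auto simp: mat_tuples_def)
    show ?thesis unfolding F(3)[OF As]
      by (intro eq_matI) (simp_all add: entry)
  qed
  then show ?thesis using that F(1,2) by blast
qed

lemma diagonally_conjugate_if_equal_ranks:
  fixes P Q :: "'a :: field mat"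
  assumes carr: "P \<in> carrier_mat n n" "Q \<in> carrier_mat n n"
    and rank: "\<And>\<gamma> C. vec_space.rank n (mat n n (\<lambda>(i, j). (if i = j then \<gamma> i else 0) + C i j * P $$ (i, j))) =
      vec_space.rank n (mat n n (\<lambda>(i, j). (if i = j then \<gamma> i else 0) + C i j * Q $$ (i, j)))"
  obtains x where "\<And>i. x i \<noteq> 0" "mat_diag n x * P * mat_diag n (\<lambda>i. 1 / x i) = Q"
proof -
  \<comment> \<open>With \<open>C\<close> supported at one position, only one entry survives, and
    the rank tells whether it vanishes. A shift \<open>z\<close> of this entry comes from
    \<open>\<gamma>\<close> and is therefore possible only on the diagonal.\<close>
  have single: "P $$ (i, j) + z = 0 \<longleftrightarrow> Q $$ (i, j) + z = 0" if ij: "i < n" "j < n" and z: "i = j \<or> z = 0" for i j z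
  proof -
    let ?E = "\<lambda>x. mat n n (\<lambda>rc. if rc = (i, j) then x else 0) :: 'a mat"
    have entry: "mat n n (\<lambda>(r, c). (if r = c then if r = i then z else 0 else 0) +
        (if (r, c) = (i, j) then 1 else 0) * A $$ (r, c)) = ?E (A $$ (i, j) + z)" for A
      using z by (intro eq_matI) auto
    have nz: "vec_space.rank n (?E x) \<noteq> vec_space.rank n (?E 0)" if "x \<noteq> 0" for x
    proof -
      have "?E x = 0\<^sub>m n n + ?E x" "?E 0 = 0\<^sub>m n n" by (auto intro!: eq_matI)
      then show ?thesis using rank_add_unit_neq[of "0\<^sub>m n n" n i j x] ij that by simp
    qed
    have eq: "vec_space.rank n (?E (P $$ (i, j) + z)) = vec_space.rank n (?E (Q $$ (i, j) + z))"
      using rank[of "\<lambda>r. if r = i then z else 0" "\<lambda>r c. if (r, c) = (i, j) then 1 else 0"]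
      unfolding entry .
    show ?thesis
    proof
      assume P0: "P $$ (i, j) + z = 0"
      have "vec_space.rank n (?E (Q $$ (i, j) + z)) = vec_space.rank n (?E 0)"
        using eq unfolding P0 by (rule sym)
      then show "Q $$ (i, j) + z = 0" using nz by blast
    next
      assume Q0: "Q $$ (i, j) + z = 0"
      have "vec_space.rank n (?E (P $$ (i, j) + z)) = vec_space.rank n (?E 0)"
        using eq unfolding Q0 .
      then show "P $$ (i, j) + z = 0" using nz by blast
    qed
  qed
  have diag_eq: "P $$ (i, i) = Q $$ (i, i)" if "i < n" for i
    using single[OF that that, of "- P $$ (i, i)"] by simp
  \<comment> \<open>With ones on the diagonal, every \<open>(i, i)\<close> belongs to the support,
    also where \<open>P\<close> vanishes; this later forces \<open>x i * y i = 1\<close>.\<close>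
  define p where "p i j = (if i = j then 1 else P $$ (i, j))" for i j
  define q where "q i j = (if i = j then 1 else Q $$ (i, j))" for i j
  have rank_pq: "vec_space.rank n (mat n n (\<lambda>(r, c). C r c * p r c)) =
      vec_space.rank n (mat n n (\<lambda>(r, c). C r c * q r c))" for C
  proof -
    \<comment> \<open>The weights on the diagonal ones are supplied by \<open>\<gamma>\<close>,
      while the true diagonal entries get weight zero.\<close>
    have "mat n n (\<lambda>(r, c). C r c * (if r = c then 1 else A $$ (r, c))) =
        mat n n (\<lambda>(r, c). (if r = c then C r r else 0) + (if r = c then 0 else C r c) * A $$ (r, c))" for A
      by (intro eq_matI) auto
    then show ?thesis unfolding p_def q_def using rank[of "\<lambda>r. C r r"] by simp
  qed
  have pq: "p r c = 0 \<longleftrightarrow> q r c = 0" if "r < n" "c < n" for r c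
    using single[OF that, of 0] by (simp add: p_def q_def)
  obtain x y where x: "\<And>r. x r \<noteq> 0"
    and xy: "\<And>r c. (r, c) \<in> {(r, c). r < n \<and> c < n \<and> q r c \<noteq> 0} \<Longrightarrow> q r c = x r * p r c * y c"
    by (rule diagonally_equivalent_on[OF rank_pq pq subset_refl]) (assumption+, rule that)
  have y_eq: "y i = 1 / x i" if "i < n" for i
    using xy[of i i] that x[of i] by (simp add: q_def p_def field_simps)
  have "mat_diag n x * P * mat_diag n (\<lambda>i. 1 / x i) = Q"
  proof (rule eq_matI)
    fix i j assume "i < dim_row Q" "j < dim_col Q"
    then have ij: "i < n" "j < n" using carr by auto
    have "(mat_diag n x * P * mat_diag n (\<lambda>i. 1 / x i)) $$ (i, j) = x i * P $$ (i, j) * (1 / x j)"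
      using ij by (simp add: mat_diag_mult_mat_diag[OF carr(1)])
    also have "\<dots> = Q $$ (i, j)"
      \<comment> \<open>Diagonal entries agree by \<open>diag_eq\<close>, zeros by
        \<open>pq\<close>, and the remaining entries by the scaling.\<close>
      using xy[of i j] ij pq[OF ij] y_eq[OF ij(2)] diag_eq[OF ij(1)] x[of i]
      by (cases "i = j"; cases "Q $$ (i, j) = 0") (auto simp: p_def q_def)
    finally show "(mat_diag n x * P * mat_diag n (\<lambda>i. 1 / x i)) $$ (i, j) = Q $$ (i, j)" .
  qed (use carr in \<open>auto simp: mat_diag_def\<close>)
  then show ?thesis using that x by blast
qed

section \<open>Orbits and the comparison of two pairs\<close>

lemma conj_act_GL:
  assumes "g \<in> GL n"
  obtains h where "h \<in> GL n" "g \<in> carrier_mat n n" "h \<in> carrier_mat n n" "g * h = 1\<^sub>m n" "h * g = 1\<^sub>m n"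
    "\<And>As. conj_act n g As = map (\<lambda>A. g * A * h) As" "\<And>As. conj_act n h As = map (\<lambda>A. h * A * g) As"
proof -
  obtain h where gh: "g \<in> carrier_mat n n" "h \<in> carrier_mat n n" "g * h = 1\<^sub>m n" "h * g = 1\<^sub>m n"
    using assms unfolding GL_iff by blast
  then have "h \<in> GL n" unfolding GL_iff by blast
  then show ?thesis
    using that gh conj_act_eq[OF gh] conj_act_eq[OF gh(2,1,4,3)] by blast
qed

lemma conj_act_mat_tuples:
  assumes "g \<in> GL n" "As \<in> mat_tuples n m"
  shows "conj_act n g As \<in> mat_tuples n m"
proof -
  obtain h where h: "g \<in> carrier_mat n n" "h \<in> carrier_mat n n" "\<And>As. conj_act n g As = map (\<lambda>A. g * A * h) As"
    by (rule conj_act_GL[OF assms(1)]) (rule that)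
  then show ?thesis using assms(2) unfolding mat_tuples_def h(3) by (auto intro!: mult_carrier_mat)
qed

lemma GL_orbit_conj_act:
  assumes g: "g \<in> GL n" and As: "As \<in> mat_tuples n m"
  shows "GL_orbit n (conj_act n g As) = GL_orbit n As"
proof -
  \<comment> \<open>Proved for all \<open>g\<close> and \<open>As\<close>, since the reverse
    inclusion is the same statement for the inverse of \<open>g\<close> and the conjugated
    tuple.\<close>
  have sub: "GL_orbit n (conj_act n g As) \<subseteq> GL_orbit n As"
    if g: "g \<in> GL n" and As: "As \<in> mat_tuples n m" for g and As :: "'a mat list"
  proof
    fix Bs assume "Bs \<in> GL_orbit n (conj_act n g As)"
    then obtain k where k: "k \<in> GL n" and Bs: "Bs = conj_act n k (conj_act n g As)"
      unfolding GL_orbit_def by blast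
    obtain h where h: "g \<in> carrier_mat n n" "h \<in> carrier_mat n n" "g * h = 1\<^sub>m n" "h * g = 1\<^sub>m n"
      "\<And>As. conj_act n g As = map (\<lambda>A. g * A * h) As" by (rule conj_act_GL[OF g]) (rule that)
    obtain l where l: "k \<in> carrier_mat n n" "l \<in> carrier_mat n n" "k * l = 1\<^sub>m n" "l * k = 1\<^sub>m n"
      "\<And>As. conj_act n k As = map (\<lambda>A. k * A * l) As" by (rule conj_act_GL[OF k]) (rule that)
    have "k * g * (h * l) = k * (g * h) * l" "h * l * (k * g) = h * (l * k) * g"
      using h(1,2) l(1,2) by (simp_all add: assoc_mult_mat[of _ n n _ n _ n])
    then have inv: "k * g * (h * l) = 1\<^sub>m n" "h * l * (k * g) = 1\<^sub>m n"
      using h l by simp_all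
    have c: "k * g \<in> carrier_mat n n" "h * l \<in> carrier_mat n n" using h l by auto
    have "Bs = map (\<lambda>A. k * g * A * (h * l)) As"
      unfolding Bs h(5) l(5) using As h(1,2) l(1,2)
      by (auto simp: mat_tuples_def assoc_mult_mat[of _ n n _ n _ n])
    then have "Bs = conj_act n (k * g) As" using conj_act_eq[OF c inv] by simp
    moreover have "k * g \<in> GL n" unfolding GL_iff using c inv by blast
    ultimately show "Bs \<in> GL_orbit n As" unfolding GL_orbit_def by blast
  qed
  obtain h where h: "h \<in> GL n" "g \<in> carrier_mat n n" "h \<in> carrier_mat n n" "h * g = 1\<^sub>m n"
    "\<And>As. conj_act n g As = map (\<lambda>A. g * A * h) As" "\<And>As. conj_act n h As = map (\<lambda>A. h * A * g) As"
    by (rule conj_act_GL[OF g]) (rule that)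
  have "h * (g * A * h) * g = A" if A: "A \<in> carrier_mat n n" for A
  proof -
    have "h * (g * A * h) * g = (h * g) * A * (h * g)"
      using h(2,3) A by (simp add: assoc_mult_mat[of _ n n _ n _ n])
    then show ?thesis using h(4) A by simp
  qed
  then have "conj_act n h (conj_act n g As) = As"
    using As unfolding h(5,6) by (auto simp: mat_tuples_def intro!: map_idI)
  then show ?thesis
    using sub[OF g As] sub[OF h(1) conj_act_mat_tuples[OF g As]] by simp
qed

text \<open>Take for \<open>t\<close> the rank on the left, which is at most \<open>n\<close>: the
  indicator is \<open>1\<close> there, hence also on the right.\<close>

lemma rank_eq_if_rank_inv_eq:
  fixes F :: "'a :: field gpoly mat"
  assumes F: "F \<in> generic_alg n m" and eq: "\<And>t. t \<le> n \<Longrightarrow> rank_inv n t F As = rank_inv n t F Bs"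
  shows "vec_space.rank n (gsubst As F) = vec_space.rank n (gsubst Bs F)"
proof -
  have "vec_space.rank n (gsubst As F) \<le> n"
    using gsubst_carrier[OF generic_alg_carrier[OF F]] by (rule vec_space.rank_le_nc)
  from eq[OF this] show ?thesis by (simp add: rank_inv_def rank_ind_def split: if_splits)
qed

lemma generic_alg_char_matrix:
  fixes c :: "'a :: field"
  obtains F where "F \<in> generic_alg n 2" "generic_deg n 2 F \<le> 1"
    "\<And>As. As \<in> mat_tuples n 2 \<Longrightarrow> gsubst As F = char_matrix (As ! 0) c"
proof -
  have u: "set (replicate x 0) \<subseteq> {..<2 :: nat}" "length (replicate x (0 :: nat)) \<le> 1" if "x \<in> {0, 1}" for x
    using that by auto
  \<comment> \<open>The index \<open>x\<close> is the exponent of the letter \<open>0\<close>: the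
    empty word has coefficient \<open>- c\<close> and the word \<open>[0]\<close> has coefficient
    \<open>1\<close>.\<close>
  obtain F where F: "F \<in> generic_alg n 2" "generic_deg n 2 F \<le> 1"
    "\<And>As. As \<in> mat_tuples n 2 \<Longrightarrow> gsubst As F =
      mat n n (\<lambda>ij. \<Sum>x\<in>{0, 1}. (if x = 0 then - c else 1) * word_mat n As (replicate x 0) $$ ij)"
    by (rule generic_alg_linear_comb[of "{0, 1}" "\<lambda>x. replicate x 0" 2 1 n "\<lambda>x. if x = 0 then - c else 1"])
      (erule u(1), erule u(2), rule that)
  have "gsubst As F = char_matrix (As ! 0) c" if As: "As \<in> mat_tuples n 2" for As
  proof -
    have A: "As ! 0 \<in> carrier_mat n n" using mat_tuples_nth[OF As] by simp
    then have "As ! 0 * 1\<^sub>m n = As ! 0" by (rule right_mult_one_mat)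
    then show ?thesis unfolding F(3)[OF As] using A
      by (intro eq_matI) (auto simp: word_mat_def char_matrix_def simp del: index_mult_mat(1))
  qed
  then show ?thesis using that F(1,2) by blast
qed

text \<open>Both pairs are conjugated so that their first matrices become the same diagonal matrix;
  then only the second matrices are left to compare.\<close>

lemma GL_orbit_eq_if_equal_ranks:
  fixes A B :: "'a :: field mat list"
  assumes n: "n \<noteq> 0" and A: "A \<in> D_set n" and B: "B \<in> D_set n"
    and rank: "\<And>t F. t \<le> n \<Longrightarrow> F \<in> generic_alg n 2 \<Longrightarrow> generic_deg n 2 F \<le> 2 * n - 1 \<Longrightarrow>
      rank_inv n t F A = rank_inv n t F B"
  shows "GL_orbit n A = GL_orbit n B"
proof -
  have At: "A \<in> mat_tuples n 2" and Bt: "B \<in> mat_tuples n 2" using A B by (auto simp: D_set_def)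
  have A0: "A ! 0 \<in> carrier_mat n n" and B0: "B ! 0 \<in> carrier_mat n n"
    using mat_tuples_nth[OF At] mat_tuples_nth[OF Bt] by auto
  \<comment> \<open>\<open>c\<close> is an eigenvalue exactly when the characteristic matrix has
    rank different from \<open>n\<close>, which is visible in degree one.\<close>
  have ev: "eigenvalue (A ! 0) c \<longleftrightarrow> eigenvalue (B ! 0) c" for c
  proof -
    obtain F where F: "F \<in> generic_alg n 2" "generic_deg n 2 F \<le> 1"
      "\<And>As. As \<in> mat_tuples n 2 \<Longrightarrow> gsubst As F = char_matrix (As ! 0) c"
      using generic_alg_char_matrix[of n c] by blast
    have "vec_space.rank n (gsubst A F) = vec_space.rank n (gsubst B F)"
      using F(2) n by (intro rank_eq_if_rank_inv_eq[OF F(1)] rank F(1)) auto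
    then show ?thesis
      unfolding eigenvalue_det[OF A0] eigenvalue_det[OF B0] F(3)[OF At] F(3)[OF Bt]
      using vec_space.det_rank_iff[OF char_matrix_closed[OF A0], of c]
        vec_space.det_rank_iff[OF char_matrix_closed[OF B0], of c] by metis
  qed
  have card: "card {c. eigenvalue (A ! 0) c} = n" using A by (simp add: D_set_def)
  \<comment> \<open>An infinite set would have cardinality \<open>0\<close>, which \<open>n\<close>
    is not.\<close>
  then have "finite {c. eigenvalue (A ! 0) c}" using n by (metis card.infinite)
  then obtain e where e: "bij_betw e {0..<n} {c. eigenvalue (A ! 0) c}"
    using ex_bij_betw_nat_finite card by blast
  then have inj: "inj_on e {..<n}" and eA: "\<And>i. i < n \<Longrightarrow> eigenvalue (A ! 0) (e i)"
    by (auto simp: bij_betw_def lessThan_atLeast0)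
  \<comment> \<open>The enumeration \<open>e\<close> is fixed in advance; by \<open>ev\<close> it
    serves \<open>B\<close> as well as \<open>A\<close>.\<close>
  have normal: "\<exists>g\<in>GL n. \<exists>P\<in>carrier_mat n n. conj_act n g As = [mat_diag n e, P]"
    if As: "As \<in> mat_tuples n 2" and ev: "\<And>i. i < n \<Longrightarrow> eigenvalue (As ! 0) (e i)" for As
  proof -
    obtain g h where gh: "g \<in> carrier_mat n n" "h \<in> carrier_mat n n" "g * h = 1\<^sub>m n" "h * g = 1\<^sub>m n"
      and D: "g * (As ! 0) * h = mat_diag n e"
      using diagonalizable_if_distinct_eigenvalues[OF mat_tuples_nth[OF As] inj ev] by auto
    obtain A1 A2 where As_eq: "As = [A1, A2]" "A2 \<in> carrier_mat n n"
      using As by (auto simp: mat_tuples_def length_Suc_conv numeral_2_eq_2)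
    have "conj_act n g As = [mat_diag n e, g * A2 * h]"
      using D unfolding conj_act_eq[OF gh] As_eq by simp
    moreover have "g \<in> GL n" "g * A2 * h \<in> carrier_mat n n" using gh As_eq unfolding GL_iff by auto
    ultimately show ?thesis by blast
  qed
  obtain g P where g: "g \<in> GL n" and P: "P \<in> carrier_mat n n" and gA: "conj_act n g A = [mat_diag n e, P]"
    using normal[OF At eA] by blast
  obtain k Q where k: "k \<in> GL n" and Q: "Q \<in> carrier_mat n n" and kB: "conj_act n k B = [mat_diag n e, Q]"
    using normal[OF Bt] eA ev by blast
  have "vec_space.rank n (mat n n (\<lambda>(i, j). (if i = j then \<gamma> i else 0) + C i j * P $$ (i, j))) =
      vec_space.rank n (mat n n (\<lambda>(i, j). (if i = j then \<gamma> i else 0) + C i j * Q $$ (i, j)))" for \<gamma> C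
  proof -
    obtain F where F: "F \<in> generic_alg n 2" "generic_deg n 2 F \<le> 2 * n - 1"
      "\<And>P. P \<in> carrier_mat n n \<Longrightarrow>
        gsubst [mat_diag n e, P] F = mat n n (\<lambda>(i, j). (if i = j then \<gamma> i else 0) + C i j * P $$ (i, j))"
      using generic_alg_interpolation[OF inj] by blast
    \<comment> \<open>Invariance carries the equality from \<open>A\<close> and \<open>B\<close>
      over to their normal forms.\<close>
    have "rank_inv n t F [mat_diag n e, P] = rank_inv n t F [mat_diag n e, Q]" if "t \<le> n" for t
      using rank_inv_invariant[OF F(1), of t] rank[OF that F(1,2)] g k At Bt
      unfolding abstract_invariants_def gA[symmetric] kB[symmetric] by auto
    then show ?thesis using rank_eq_if_rank_inv_eq[OF F(1)] F(3)[OF P] F(3)[OF Q] by metis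
  qed
  then obtain x where x: "\<And>i. x i \<noteq> 0" and PQ: "mat_diag n x * P * mat_diag n (\<lambda>i. 1 / x i) = Q"
    using diagonally_conjugate_if_equal_ranks[OF P Q] by blast
  \<comment> \<open>Diagonal matrices commute, so conjugating \<open>P\<close> into \<open>Q\<close>
    by one of them does not disturb the first matrix.\<close>
  have "mat_diag n x * mat_diag n e * mat_diag n (\<lambda>i. 1 / x i) = mat_diag n e"
    using x by simp
  then have "conj_act n (mat_diag n x) [mat_diag n e, P] = [mat_diag n e, Q]"
    using conj_act_eq[OF mat_diag_dim mat_diag_dim mat_diag_inverse[of x, OF x]] PQ by simp
  moreover have "mat_diag n x \<in> GL n" unfolding GL_iff using mat_diag_inverse[of x, OF x] mat_diag_dim by blast
  moreover have "[mat_diag n e, P] \<in> mat_tuples n 2" using P by (auto simp: mat_tuples_def)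
  ultimately have "GL_orbit n [mat_diag n e, P] = GL_orbit n [mat_diag n e, Q]"
    using GL_orbit_conj_act by metis
  then show ?thesis
    using GL_orbit_conj_act[OF g At] GL_orbit_conj_act[OF k Bt] gA kB by simp
qed

theorem corollary4p5:
  fixes n :: nat
  assumes "n \<ge> 2"
    and "\<exists>S :: 'a :: field set. finite S \<and> card S = n"
  shows "(\<forall>t F. t \<le> n \<and> F \<in> generic_alg n 2 \<and> generic_deg n 2 F \<le> (n + 1) * (2 * n - 1) \<longrightarrow>
            (rank_inv n t F :: 'a mat list \<Rightarrow> 'a) \<in> abstract_invariants n 2 \<and>
            width n 2 (rank_inv n t F) = 1) \<and>
         (\<forall>A\<in>D_set n. \<forall>B\<in>D_set n.
            (\<forall>t F. t \<le> n \<and> F \<in> generic_alg n 2 \<and> generic_deg n 2 F \<le> (n + 1) * (2 * n - 1) \<longrightarrow>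
               (rank_inv n t F A :: 'a) = rank_inv n t F B) \<longrightarrow>
            GL_orbit n A = GL_orbit n B)"
proof (intro conjI allI impI ballI)
  fix t and F :: "'a gpoly mat"
  assume *: "t \<le> n \<and> F \<in> generic_alg n 2 \<and> generic_deg n 2 F \<le> (n + 1) * (2 * n - 1)"
  show "rank_inv n t F \<in> abstract_invariants n 2" using * rank_inv_invariant by blast
  show "width n 2 (rank_inv n t F) = 1" using * width_rank_inv by blast
next
  fix A B :: "'a mat list"
  assume AB: "A \<in> D_set n" "B \<in> D_set n"
    and eq: "\<forall>t F. t \<le> n \<and> F \<in> generic_alg n 2 \<and> generic_deg n 2 F \<le> (n + 1) * (2 * n - 1) \<longrightarrow>
               (rank_inv n t F A :: 'a) = rank_inv n t F B"
  show "GL_orbit n A = GL_orbit n B"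
  \<comment> \<open>The invariants of degree at most \<open>2 * n - 1\<close> are among those
    assumed to agree.\<close>
  proof (rule GL_orbit_eq_if_equal_ranks[OF _ AB])
    fix t and F :: "'a gpoly mat"
    assume "t \<le> n" "F \<in> generic_alg n 2" "generic_deg n 2 F \<le> 2 * n - 1"
    moreover from this(3) have "generic_deg n 2 F \<le> (n + 1) * (2 * n - 1)"
      by (rule order_trans) simp
    ultimately show "rank_inv n t F A = rank_inv n t F B" using eq by blast
  qed (use assms(1) in simp)
qed

end
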